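(* Let $p>2$ and $\gamma_p=\big(\frac{p-2}{\pi}\big)^{1/2}$, let $\mathcal{D}\subset\mathbb{H}$ be open, bounded and connected, and let $F\in\mathcal{C}(\mathbb{H})$ be bounded. For every $\epsilon\in(0,1)$ there exists a unique function $u:\mathbb{H}\to\mathbb{R}$ (denoted $u_\epsilon$), automatically continuous and bounded, such that for all $q\in\mathbb{H}$: $$u(q)=d_\epsilon(q)\Big(\frac13\mathcal{A}_3(u,\epsilon)(q)+\frac13\inf_{q'\in B_{\gamma_p\epsilon}(q)}\mathcal{A}_3(u,\epsilon)(q')+\frac13\sup_{q'\in B_{\gamma_p\epsilon}(q)}\mathcal{A}_3(u,\epsilon)(q')\Big)+\big(1-d_\epsilon(q)\big)F(q).$$ Moreover, the solution operator is monotone: if $F\le\bar F$ are two bounded continuous data functions, then the corresponding solutions satisfy $u_\epsilon\le\bar u_\epsilon$.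
   Context: $\mathbb{H}=(\mathbb{R}^3,* )$ is the first Heisenberg group with $(x,y,z)*(x',y',z')=(x+x',y+y',z+z'+\frac12(xy'-yx'))$. The Korányi gauge is $|(x,y,z)|_K=((x^2+y^2)^2+16z^2)^{1/4}$, the metric is $d(q,q')=|q^{-1}*q'|_K$, and $B_r(q)=\{q'\in\mathbb{H}: d(q,q')<r\}$. Define $\mathcal{A}_3(v,r)(q)=\frac{1}{|B_r(q)|}\int_{B_r(q)}v(p)\,dp$ (Lebesgue measure on $\mathbb{R}^3$), and $d_\epsilon(q)=\frac1\epsilon\min\{\epsilon,\mathrm{dist}(q,\mathbb{H}\setminus\mathcal{D})\}$, where $\mathrm{dist}$ is with respect to $d$. Functions $u$ under consideration are locally integrable, so that the averages are defined. *)

theory Defs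
  imports "HOL-Analysis.Analysis"
begin

text \<open>The first Heisenberg group on the underlying space of triples of reals. The topology,
  boundedness and Lebesgue measure on it are those of the library for the Euclidean space
  \<^typ>\<open>real \<times> real \<times> real\<close>; the metric \<open>heis_dist\<close> below induces the same topology and
  the same bounded sets.\<close>

type_synonym heis = "real \<times> real \<times> real"

fun heis_mult :: "heis \<Rightarrow> heis \<Rightarrow> heis"  (infixl "\<star>" 70) where
  "(x, y, z) \<star> (x', y', z') = (x + x', y + y', z + z' + (1/2) * (x * y' - y * x'))"

fun heis_inv :: "heis \<Rightarrow> heis" where
  "heis_inv (x, y, z) = (- x, - y, - z)"

lemma heis_group:
  "(a \<star> b) \<star> c = a \<star> (b \<star> c)" "(0, 0, 0) \<star> a = a" "a \<star> (0, 0, 0) = a"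
  "heis_inv a \<star> a = (0, 0, 0)" "a \<star> heis_inv a = (0, 0, 0)"
  by (cases a; cases b; cases c; simp add: algebra_simps)+

fun koranyi_gauge :: "heis \<Rightarrow> real" where
  "koranyi_gauge (x, y, z) = root 4 ((x^2 + y^2)^2 + 16 * z^2)"

definition heis_dist :: "heis \<Rightarrow> heis \<Rightarrow> real" where
  "heis_dist q q' = koranyi_gauge (heis_inv q \<star> q')"

definition heis_ball :: "real \<Rightarrow> heis \<Rightarrow> heis set" where
  "heis_ball r q = {q'. heis_dist q q' < r}"

definition heis_setdist :: "heis \<Rightarrow> heis set \<Rightarrow> real" where
  "heis_setdist q S = (INF q'\<in>S. heis_dist q q')"

definition average3 :: "(heis \<Rightarrow> real) \<Rightarrow> real \<Rightarrow> heis \<Rightarrow> real" where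
  "average3 v r q = (1 / measure lebesgue (heis_ball r q)) * (LINT p:heis_ball r q|lebesgue. v p)"

definition locally_integrable :: "(heis \<Rightarrow> real) \<Rightarrow> bool" where
  "locally_integrable v \<longleftrightarrow> (\<forall>K. compact K \<longrightarrow> set_integrable lebesgue K v)"

definition d_eps :: "heis set \<Rightarrow> real \<Rightarrow> heis \<Rightarrow> real" where
  "d_eps D \<epsilon> q = (1 / \<epsilon>) * min \<epsilon> (heis_setdist q (- D))"

definition gamma_p :: "real \<Rightarrow> real" where
  "gamma_p p = sqrt ((p - 2) / pi)"

text \<open>The averages of a locally integrable function are locally bounded, so the real-valued
  \<open>INF\<close> and \<open>SUP\<close> over balls are the true infimum and supremum.\<close>

definition is_solution ::
    "real \<Rightarrow> heis set \<Rightarrow> (heis \<Rightarrow> real) \<Rightarrow> real \<Rightarrow> (heis \<Rightarrow> real) \<Rightarrow> bool" where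
  "is_solution p D F \<epsilon> u \<longleftrightarrow> locally_integrable u \<and>
     (\<forall>q. u q =
        d_eps D \<epsilon> q *
          (1/3 * average3 u \<epsilon> q
           + 1/3 * (INF q'\<in>heis_ball (gamma_p p * \<epsilon>) q. average3 u \<epsilon> q')
           + 1/3 * (SUP q'\<in>heis_ball (gamma_p p * \<epsilon>) q. average3 u \<epsilon> q'))
        + (1 - d_eps D \<epsilon> q) * F q)"

end

theory Submission
  imports Defs
begin

text \<open>
  Averages of locally integrable functions are continuous, because Koranyi spheres are null sets, so
  every solution is continuous, and bounded since it agrees with \<open>F\<close> off the bounded set \<open>D\<close>.
  Monotonicity, and with it uniqueness, is a strong maximum principle for the difference of two
  solutions. For existence, iterate the right-hand side of the equation from a constant lower bound
  of \<open>F\<close>: the iterates are continuous, increasing and bounded, and their pointwise limit is a solution.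
  The passage to the limit inside the infimum uses that, by Dini's theorem, the averages converge
  uniformly on compact sets.
\<close>

section \<open>The Koranyi gauge and its triangle inequality\<close>

text \<open>Reading the gauge as a complex modulus makes the complex triangle inequality and the
  bounds on real and imaginary parts available.\<close>

lemma koranyi_gauge_eq_sqrt_cmod:
  "koranyi_gauge (x, y, z) = sqrt (cmod (Complex (x\<^sup>2 + y\<^sup>2) (4 * z)))"
proof -
  have "root 4 t = sqrt (sqrt t)" for t
    using real_root_mult_exp[of 2 2 t] by (simp add: sqrt_def)
  then show ?thesis by (simp add: cmod_def power_mult_distrib)
qed

lemma koranyi_gauge_nonneg [simp]: "0 \<le> koranyi_gauge a"
  by (cases a) (simp add: koranyi_gauge_eq_sqrt_cmod)

lemma koranyi_gauge_inv: "koranyi_gauge (heis_inv a) = koranyi_gauge a"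
  by (cases a) simp

text \<open>Cygan's argument: put \<zeta> = x + iy and \<alpha> = |\<zeta>|^2 + 4iz. The product of
  the two points has the complex number \<alpha> + \<alpha>' + 2 conj(\<zeta>) \<zeta>', because the
  twist in the group law is half the imaginary part of conj(\<zeta>) \<zeta>'. Since |\<zeta>| is at
  most sqrt |\<alpha>|, its modulus is at most (sqrt |\<alpha>| + sqrt |\<alpha>'|)^2.\<close>

lemma koranyi_gauge_mult_le: "koranyi_gauge (a \<star> b) \<le> koranyi_gauge a + koranyi_gauge b"
proof (cases a; cases b)
  fix x y z x' y' z' assume ab: "a = (x, y, z)" "b = (x', y', z')"
  define \<alpha> \<alpha>' where "\<alpha> = Complex (x\<^sup>2 + y\<^sup>2) (4 * z)" and "\<alpha>' = Complex (x'\<^sup>2 + y'\<^sup>2) (4 * z')"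
  define \<zeta> \<zeta>' where "\<zeta> = Complex x y" and "\<zeta>' = Complex x' y'"
  note defs = \<alpha>_def \<alpha>'_def \<zeta>_def \<zeta>'_def
  have g: "koranyi_gauge a = sqrt (cmod \<alpha>)" "koranyi_gauge b = sqrt (cmod \<alpha>')"
    by (simp_all add: ab koranyi_gauge_eq_sqrt_cmod defs del: koranyi_gauge.simps)
  have le: "cmod \<zeta> \<le> sqrt (cmod \<alpha>)" "cmod \<zeta>' \<le> sqrt (cmod \<alpha>')"
    using abs_Re_le_cmod[of \<alpha>] abs_Re_le_cmod[of \<alpha>']
    by (auto simp: defs cmod_def intro!: real_sqrt_le_mono)
  have "koranyi_gauge (a \<star> b) = sqrt (cmod (\<alpha> + \<alpha>' + 2 * (cnj \<zeta> * \<zeta>')))"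
    unfolding ab heis_mult.simps koranyi_gauge_eq_sqrt_cmod
    by (rule arg_cong[where f = "\<lambda>c. sqrt (cmod c)"])
       (simp add: complex_eq_iff defs power2_eq_square algebra_simps)
  also have "\<dots> \<le> sqrt (cmod \<alpha> + cmod \<alpha>' + 2 * (cmod \<zeta> * cmod \<zeta>'))"
  proof (rule real_sqrt_le_mono)
    have "cmod (2 * (cnj \<zeta> * \<zeta>')) = 2 * (cmod \<zeta> * cmod \<zeta>')" by (simp add: norm_mult)
    then show "cmod (\<alpha> + \<alpha>' + 2 * (cnj \<zeta> * \<zeta>')) \<le> cmod \<alpha> + cmod \<alpha>' + 2 * (cmod \<zeta> * cmod \<zeta>')"
      by (metis add_right_mono norm_triangle_ineq order_trans)
  qed
  also have "\<dots> \<le> sqrt ((sqrt (cmod \<alpha>) + sqrt (cmod \<alpha>'))\<^sup>2)"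
    using mult_mono[OF le] by (intro real_sqrt_le_mono) (simp add: power2_sum)
  finally show ?thesis by (simp add: g)
qed

section \<open>The Koranyi metric, its continuity and its compact balls\<close>

lemma heis_dist_nonneg [simp]: "0 \<le> heis_dist q q'"
  by (simp add: heis_dist_def)

lemma heis_dist_self [simp]: "heis_dist q q = 0"
  by (simp add: heis_dist_def heis_group)

lemma heis_dist_commute: "heis_dist q q' = heis_dist q' q"
proof -
  have "heis_inv (heis_inv q \<star> q') = heis_inv q' \<star> q"
    by (cases q; cases q') (simp add: algebra_simps)
  then show ?thesis by (metis heis_dist_def koranyi_gauge_inv)
qed

lemma heis_dist_triangle: "heis_dist q s \<le> heis_dist q q' + heis_dist q' s"
proof -
  have "heis_inv q \<star> s = (heis_inv q \<star> q') \<star> (heis_inv q' \<star> s)"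
    by (metis heis_group(1,2,5))
  then show ?thesis
    unfolding heis_dist_def using koranyi_gauge_mult_le by simp
qed

lemma heis_dist_mult_right: "heis_dist q (q \<star> b) = koranyi_gauge b"
  unfolding heis_dist_def by (metis heis_group(1,2,4))

text \<open>Coordinates enter through projections instead of pattern matching, so that the
  continuity rules apply to the formula.\<close>

lemma heis_dist_eq:
  "heis_dist q p = root 4 (((fst p - fst q)\<^sup>2 + (fst (snd p) - fst (snd q))\<^sup>2)\<^sup>2
     + 16 * (snd (snd p) - snd (snd q) + 1/2 * (fst (snd q) * fst p - fst q * fst (snd p)))\<^sup>2)"
  by (cases q; cases p) (simp add: heis_dist_def algebra_simps)

lemma continuous_on_heis_dist [continuous_intros]:
  assumes "continuous_on S f" "continuous_on S g"
  shows "continuous_on S (\<lambda>x. heis_dist (f x) (g x))"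
  unfolding heis_dist_eq by (intro continuous_intros assms) auto

lemma continuous_on_heis_mult [continuous_intros]:
  assumes "continuous_on S f" "continuous_on S g"
  shows "continuous_on S (\<lambda>x. f x \<star> g x)"
proof -
  have "q \<star> p = (fst q + fst p, fst (snd q) + fst (snd p),
      snd (snd q) + snd (snd p) + 1/2 * (fst q * fst (snd p) - fst (snd q) * fst p))" for q p
    by (cases q; cases p) simp
  then show ?thesis by (auto intro!: continuous_intros assms)
qed

text \<open>The real and imaginary parts of the complex number behind the gauge confine the point to
  an anisotropic box: order \<open>R\<close> horizontally, order \<open>R\<^sup>2\<close>
  vertically.\<close>

lemma bounded_koranyi_gauge_le: "bounded {a. koranyi_gauge a \<le> R}"
proof (cases "0 \<le> R")
  case True
  have box: "\<bar>x\<bar> \<le> R \<and> \<bar>y\<bar> \<le> R \<and> \<bar>z\<bar> \<le> R\<^sup>2" if "koranyi_gauge (x, y, z) \<le> R" for x y z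
  proof -
    have *: "cmod (Complex (x\<^sup>2 + y\<^sup>2) (4 * z)) \<le> R\<^sup>2"
      using that by (simp add: koranyi_gauge_eq_sqrt_cmod sqrt_le_D del: koranyi_gauge.simps)
    have "x\<^sup>2 + y\<^sup>2 \<le> R\<^sup>2" "\<bar>4 * z\<bar> \<le> R\<^sup>2"
      using abs_Re_le_cmod[of "Complex (x\<^sup>2 + y\<^sup>2) (4 * z)"]
        abs_Im_le_cmod[of "Complex (x\<^sup>2 + y\<^sup>2) (4 * z)"] * by auto
    moreover from this have "x\<^sup>2 \<le> R\<^sup>2" "y\<^sup>2 \<le> R\<^sup>2"
      using zero_le_power2[of x] zero_le_power2[of y] by linarith+
    ultimately show ?thesis
      using True abs_le_square_iff[of x R] abs_le_square_iff[of y R] by auto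
  qed
  then have "{a. koranyi_gauge a \<le> R} \<subseteq> {- R..R} \<times> {- R..R} \<times> {- R\<^sup>2..R\<^sup>2}"
  proof (intro subsetI)
    fix a assume a: "a \<in> {a. koranyi_gauge a \<le> R}"
    obtain x y z where "a = (x, y, z)" by (cases a)
    then show "a \<in> {- R..R} \<times> {- R..R} \<times> {- R\<^sup>2..R\<^sup>2}"
      using box[of x y z] a by (auto simp del: koranyi_gauge.simps)
  qed
  then show ?thesis
    by (rule bounded_subset[rotated]) (intro bounded_Times bounded_closed_interval)
next
  case False
  then have "\<not> koranyi_gauge a \<le> R" for a
    using koranyi_gauge_nonneg[of a] by linarith
  then show ?thesis by (simp del: koranyi_gauge.simps)
qed

text \<open>Closed because the metric is continuous in the Euclidean topology, bounded by the
  triangle inequality through the origin. This compactness bounds continuous functions on balls and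
  later feeds Dini's theorem.\<close>

lemma compact_heis_cball: "compact {p. heis_dist q p \<le> R}"
proof -
  have "koranyi_gauge p \<le> koranyi_gauge q + heis_dist q p" for p
    using heis_dist_triangle[of "(0,0,0)" p q]
    by (cases p; cases q) (simp add: heis_dist_def)
  then have "{p. heis_dist q p \<le> R} \<subseteq> {a. koranyi_gauge a \<le> koranyi_gauge q + R}"
    by (smt (verit) Collect_mono)
  then have "bounded {p. heis_dist q p \<le> R}"
    using bounded_koranyi_gauge_le bounded_subset by blast
  moreover have "closed {p. heis_dist q p \<le> R}"
    by (intro closed_Collect_le continuous_intros)
  ultimately show ?thesis by (simp add: compact_eq_bounded_closed)
qed

lemma open_heis_ball: "open (heis_ball r q)"
  unfolding heis_ball_def by (intro open_Collect_less continuous_intros)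

lemma heis_ball_subset_cball: "heis_ball r q \<subseteq> {p. heis_dist q p \<le> r}"
  by (auto simp: heis_ball_def)

lemma center_in_heis_ball: "0 < r \<Longrightarrow> q \<in> heis_ball r q"
  by (simp add: heis_ball_def)

lemma heis_ball_nonempty: "0 < r \<Longrightarrow> heis_ball r q \<noteq> {}"
  using center_in_heis_ball by blast

section \<open>Balls as translates, and the measure of balls and spheres\<close>

text \<open>Turns an extremum over a moving ball into one over a fixed index set, with the centre
  moved into the function.\<close>

lemma heis_ball_eq_translate: "heis_ball r q = (\<lambda>b. q \<star> b) ` {b. koranyi_gauge b < r}"
proof -
  have "q' = q \<star> (heis_inv q \<star> q')" for q' by (metis heis_group(1,2,5))
  then show ?thesis
    by (auto simp: heis_ball_def heis_dist_mult_right) (metis heis_dist_def image_eqI mem_Collect_eq)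
qed

lemma heis_ball_fmeasurable: "heis_ball r q \<in> lmeasurable"
  using bounded_subset[OF compact_imp_bounded[OF compact_heis_cball] heis_ball_subset_cball]
  by (rule lmeasurable_open[OF _ open_heis_ball])

lemma measure_heis_ball_pos:
  assumes "0 < r" shows "0 < measure lebesgue (heis_ball r q)"
proof -
  have "\<not> negligible (heis_ball r q)"
    using assms open_heis_ball heis_ball_nonempty open_not_negligible by blast
  then show ?thesis
    using heis_ball_fmeasurable negligible_iff_measure zero_less_measure_iff
    by (metis)
qed

text \<open>Left translations are affine, so Koranyi spheres meet every Euclidean ray from their centre
  at most once.\<close>

lemma negligible_heis_sphere:
  assumes "0 < r" shows "negligible {p. heis_dist q p = r}"
proof (rule starlike_negligible_strong[where a = q])
  show "closed {p. heis_dist q p = r}"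
    by (intro closed_Collect_eq continuous_intros)
next
  fix c :: real and h
  assume c: "0 \<le> c" "c < 1" and r: "q + h \<in> {p. heis_dist q p = r}"
  obtain x y z where q: "q = (x, y, z)" by (cases q)
  obtain a b d where h: "h = (a, b, d)" by (cases h)
  \<comment> \<open>\<open>e\<close> is the vertical coordinate of the inverse of \<open>q\<close>
    times \<open>q + h\<close>. It is linear in \<open>h\<close>, so replacing \<open>h\<close> by
    \<open>t *\<^sub>R h\<close> scales it by \<open>t\<close>; this gives the powers of
    \<open>t\<close> in \<open>dist\<close>.\<close>
  define e where "e = d + 1/2 * (y * a - x * b)"
  define A B where "A = (a\<^sup>2 + b\<^sup>2)\<^sup>2" and "B = 16 * e\<^sup>2"
  have dist: "heis_dist q (q + t *\<^sub>R h) = root 4 (t^4 * A + t\<^sup>2 * B)" for t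
    unfolding heis_dist_eq q h A_def B_def e_def
    by (rule arg_cong[where f = "root 4"])
       (simp add: algebra_simps power2_eq_square power4_eq_xxxx)
  have "root 4 (A + B) = r" using r dist[of 1] by simp
  then have pos: "A + B > 0" using assms real_root_gt_0_iff by fastforce
  have AB: "0 \<le> A" "0 \<le> B" by (simp_all add: A_def B_def)
  have c2: "c\<^sup>2 < 1" using c by (simp add: power_less_one_iff abs_square_less_1)
  have c4: "c^4 \<le> c\<^sup>2" using c by (simp add: power_decreasing)
  have "c^4 * A + c\<^sup>2 * B \<le> c\<^sup>2 * (A + B)"
    using mult_right_mono[OF c4 AB(1)] by (simp add: algebra_simps)
  also have "\<dots> < A + B" using pos c2 by simp
  finally have "heis_dist q (q + c *\<^sub>R h) < r"
    unfolding dist \<open>root 4 (A + B) = r\<close>[symmetric] by simp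
  then show "q + c *\<^sub>R h \<notin> {p. heis_dist q p = r}" by simp
qed

section \<open>Local integrability and averages over balls\<close>

lemma continuous_imp_locally_integrable:
  assumes "continuous_on UNIV v" shows "locally_integrable v"
  unfolding locally_integrable_def set_integrable_def
proof (intro allI impI)
  fix K :: "heis set" assume "compact K"
  moreover have "continuous_on K v" using assms continuous_on_subset by blast
  ultimately have int: "integrable lborel (\<lambda>x. indicator K x *\<^sub>R v x)"
    by (rule borel_integrable_compact)
  then show "integrable lebesgue (\<lambda>x. indicator K x *\<^sub>R v x)"
    using integrable_completion[OF borel_measurable_integrable[OF int]] by simp
qed

lemma set_integrable_heis_ball:
  "locally_integrable v \<Longrightarrow> set_integrable lebesgue (heis_ball r q) v"
  unfolding locally_integrable_def
  by (meson set_integrable_subset compact_heis_cball fmeasurableD heis_ball_fmeasurable heis_ball_subset_cball)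

text \<open>Dominated convergence along a sequence of centres: the indicators of the balls converge
  off the limiting sphere, which is a null set.\<close>

lemma continuous_on_heis_ball_integral:
  assumes "locally_integrable v" "0 < r"
  shows "continuous_on UNIV (\<lambda>q. LINT p:heis_ball r q|lebesgue. v p)"
proof -
  have "(\<lambda>n. LINT p:heis_ball r (X n)|lebesgue. v p) \<longlonglongrightarrow> (LINT p:heis_ball r a|lebesgue. v p)"
    if X: "X \<longlonglongrightarrow> a" for X a
  proof -
    have "continuous_on UNIV (heis_dist p)" for p
      by (intro continuous_intros)
    then have lim: "(\<lambda>n. heis_dist p (X n)) \<longlonglongrightarrow> heis_dist p a" for p
      using X by (rule continuous_on_tendsto_compose) auto
    then have "Bseq (\<lambda>n. heis_dist a (X n))"
      using convergent_imp_Bseq convergentI by blast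
    then obtain R where "\<forall>n. norm (heis_dist a (X n)) \<le> R"
      by (rule BseqE)
    then have R: "heis_dist a (X n) \<le> R" for n
      by simp
    \<comment> \<open>\<open>R\<close> bounds the distance from \<open>a\<close> to all centres, so
      this one compact ball contains all the moving balls, and \<open>v\<close> restricted to it is
      the dominating function.\<close>
    define K where "K = {p. heis_dist a p \<le> R + r}"
    have K: "heis_ball r (X n) \<subseteq> K" for n
    proof
      fix s assume "s \<in> heis_ball r (X n)"
      then show "s \<in> K"
        using heis_dist_triangle[of a s "X n"] R[of n] by (simp add: K_def heis_ball_def)
    qed
    have intK: "integrable lebesgue (\<lambda>p. indicat_real K p *\<^sub>R v p)"
      using assms(1) compact_heis_cball
      unfolding K_def locally_integrable_def set_integrable_def by blast
    show ?thesis
      unfolding set_lebesgue_integral_def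
    proof (rule integral_dominated_convergence[where w = "\<lambda>p. norm (indicat_real K p *\<^sub>R v p)"])
      show "integrable lebesgue (\<lambda>p. norm (indicat_real K p *\<^sub>R v p))"
        using intK by (rule integrable_norm)
      show "(\<lambda>p. indicat_real (heis_ball r a) p *\<^sub>R v p) \<in> borel_measurable lebesgue"
        "\<And>n. (\<lambda>p. indicat_real (heis_ball r (X n)) p *\<^sub>R v p) \<in> borel_measurable lebesgue"
        using set_integrable_heis_ball[OF assms(1)]
        unfolding set_integrable_def by (auto intro: borel_measurable_integrable)
      show "AE p in lebesgue. norm (indicat_real (heis_ball r (X n)) p *\<^sub>R v p)
          \<le> norm (indicat_real K p *\<^sub>R v p)" for n
        using K[of n] by (intro AE_I2) (auto simp: indicator_def)
      have "AE p in lebesgue. p \<notin> {p. heis_dist a p = r}"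
        using negligible_heis_sphere[OF assms(2)] negligible_iff_null_sets AE_not_in by blast
      then show "AE p in lebesgue. (\<lambda>n. indicat_real (heis_ball r (X n)) p *\<^sub>R v p)
          \<longlonglongrightarrow> indicat_real (heis_ball r a) p *\<^sub>R v p"
      proof eventually_elim
        case (elim p)
        have l: "(\<lambda>n. heis_dist (X n) p) \<longlonglongrightarrow> heis_dist a p"
          using lim[of p] by (simp add: heis_dist_commute)
        \<comment> \<open>Off the sphere the limiting distance differs strictly from
          \<open>r\<close>, so membership in the moving balls is eventually constant.\<close>
        have "\<forall>\<^sub>F n in sequentially. (heis_dist (X n) p < r) = (heis_dist a p < r)"
        proof (cases "heis_dist a p < r")
          case True
          then show ?thesis using order_tendstoD(2)[OF l True] by simp
        next
          case False
          then have "r < heis_dist a p" using elim by simp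
          then show ?thesis
            using order_tendstoD(1)[OF l] False by (fastforce elim: eventually_mono)
        qed
        then have "\<forall>\<^sub>F n in sequentially. indicat_real (heis_ball r (X n)) p *\<^sub>R v p
            = indicat_real (heis_ball r a) p *\<^sub>R v p"
          by eventually_elim (simp add: heis_ball_def indicator_def)
        then show ?case by (rule tendsto_eventually)
      qed
    qed
  qed
  then show ?thesis by (simp add: continuous_on_sequentially comp_def)
qed

text \<open>Makes the continuity of the denominator of the average a special case of the continuity
  of the numerator.\<close>

lemma measure_heis_ball_eq_integral:
  "measure lebesgue (heis_ball r q) = (LINT p:heis_ball r q|lebesgue. 1)"
  using heis_ball_fmeasurable[of r q]
  by (simp add: set_lebesgue_integral_def lmeasure_integral_UNIV fmeasurable_def)

lemma continuous_on_average3: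
  assumes "locally_integrable v" "0 < r"
  shows "continuous_on UNIV (average3 v r)"
proof -
  have "continuous_on UNIV (\<lambda>q. measure lebesgue (heis_ball r q))"
    unfolding measure_heis_ball_eq_integral
    by (intro continuous_on_heis_ball_integral continuous_imp_locally_integrable assms continuous_intros)
  moreover have "measure lebesgue (heis_ball r q) \<noteq> 0" for q
    using measure_heis_ball_pos[OF assms(2)] by (metis less_irrefl)
  ultimately show ?thesis
    unfolding average3_def[abs_def]
    by (intro continuous_intros continuous_on_heis_ball_integral assms) auto
qed

lemma average3_mono:
  assumes "locally_integrable u" "locally_integrable v" "\<And>q. u q \<le> v q"
  shows "average3 u r q \<le> average3 v r q"
  unfolding average3_def
  by (intro mult_left_mono set_integral_mono set_integrable_heis_ball assms) simp

lemma average3_const: "0 < r \<Longrightarrow> average3 (\<lambda>_. c) r q = c"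
  using measure_heis_ball_pos[of r q] measure_heis_ball_eq_integral[of r q]
    set_integral_mult_right[of lebesgue "heis_ball r q" c "\<lambda>_. 1"]
  by (simp add: average3_def)

lemma average3_diff:
  assumes "locally_integrable u" "locally_integrable v"
  shows "average3 (\<lambda>p. u p - v p) r q = average3 u r q - average3 v r q"
  unfolding average3_def
  by (simp add: set_integral_diff set_integrable_heis_ball assms right_diff_distrib diff_divide_distrib)

text \<open>The function \<open>M - w\<close> is nonnegative with nonpositive integral over the
  ball, so it vanishes almost everywhere there. The set where \<open>w = M\<close> is closed and the
  ball is open, which upgrades this to every point.\<close>

lemma average3_le_imp_eq_on_heis_ball:
  assumes w: "continuous_on UNIV w" and le: "\<And>q. w q \<le> M" and "0 < r"
    and avg: "M \<le> average3 w r q" and p: "p \<in> heis_ball r q"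
  shows "w p = M"
proof -
  let ?B = "heis_ball r q"
  define f where "f = (\<lambda>p. M - w p)"
  have f: "locally_integrable f"
    unfolding f_def by (intro continuous_imp_locally_integrable continuous_intros w)
  have c: "locally_integrable (\<lambda>_. M)" "locally_integrable w"
    by (intro continuous_imp_locally_integrable continuous_intros w)+
  have "average3 f r q = M - average3 w r q"
    using average3_diff[OF c] average3_const[OF \<open>0 < r\<close>] by (simp add: f_def)
  then have "(LINT p:?B|lebesgue. f p) \<le> 0"
    using avg measure_heis_ball_pos[OF \<open>0 < r\<close>, of q]
    by (simp add: average3_def field_simps)
  moreover have int: "integrable lebesgue (\<lambda>p. indicat_real ?B p *\<^sub>R f p)"
    using set_integrable_heis_ball[OF f] by (simp add: set_integrable_def)
  moreover have nonneg: "0 \<le> indicat_real ?B p *\<^sub>R f p" for p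
    using le[of p] by (simp add: f_def)
  moreover from this have "0 \<le> (LINT p|lebesgue. indicat_real ?B p *\<^sub>R f p)"
    by (intro integral_nonneg_AE AE_I2)
  ultimately have "(LINT p|lebesgue. indicat_real ?B p *\<^sub>R f p) = 0"
    unfolding set_lebesgue_integral_def by linarith
  then have "AE p in lebesgue. indicat_real ?B p *\<^sub>R f p = 0"
    using integral_nonneg_eq_0_iff_AE[OF int] nonneg by auto
  then have "AE p \<in> ?B in lebesgue. p \<in> {p. w p = M}"
    by eventually_elim (auto simp: f_def)
  moreover have "closed {p. w p = M}"
    by (intro closed_Collect_eq w continuous_intros)
  ultimately show ?thesis
    using mem_closed_if_AE_lebesgue_open[OF open_heis_ball _ _ p] by blast
qed

section \<open>Suprema and infima over balls\<close>

text \<open>The supremum is 1-Lipschitz in the uniform norm. This gives both its continuity in the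
  centre of the ball and its stability under uniform limits.\<close>

lemma abs_SUP_diff_le:
  fixes f g :: "'a \<Rightarrow> real"
  assumes "S \<noteq> {}" "bdd_above (f ` S)" "bdd_above (g ` S)" "\<And>x. x \<in> S \<Longrightarrow> \<bar>f x - g x\<bar> \<le> e"
  shows "\<bar>(SUP x\<in>S. f x) - (SUP x\<in>S. g x)\<bar> \<le> e"
proof -
  have "(SUP x\<in>S. f x) \<le> (SUP x\<in>S. g x) + e"
  proof (rule cSUP_least[OF assms(1)])
    fix x assume x: "x \<in> S"
    show "f x \<le> (SUP x\<in>S. g x) + e"
      using cSUP_upper[OF x assms(3)] assms(4)[OF x] by linarith
  qed
  moreover have "(SUP x\<in>S. g x) \<le> (SUP x\<in>S. f x) + e"
  proof (rule cSUP_least[OF assms(1)])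
    fix x assume x: "x \<in> S"
    show "g x \<le> (SUP x\<in>S. f x) + e"
      using cSUP_upper[OF x assms(2)] assms(4)[OF x] by linarith
  qed
  ultimately show ?thesis by linarith
qed

lemma INF_eq_uminus_SUP: "(INF x\<in>S. f x :: real) = - (SUP x\<in>S. - f x)"
  by (simp add: Inf_real_def image_image)

text \<open>Boundedness is what makes the real-valued \<open>SUP\<close> and \<open>INF\<close> over
  balls genuine extrema.\<close>

lemma bdd_heis_ball_image:
  fixes g :: "heis \<Rightarrow> real"
  assumes "continuous_on UNIV g"
  shows "bdd_above (g ` heis_ball r q)" "bdd_below (g ` heis_ball r q)"
proof -
  have "compact (g ` {p. heis_dist q p \<le> r})"
    using assms compact_heis_cball compact_continuous_image continuous_on_subset by blast
  then have "bounded (g ` heis_ball r q)"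
    by (rule bounded_subset[OF compact_imp_bounded image_mono[OF heis_ball_subset_cball]])
  then show "bdd_above (g ` heis_ball r q)" "bdd_below (g ` heis_ball r q)"
    by (simp_all add: bounded_imp_bdd_above bounded_imp_bdd_below)
qed

lemma continuous_on_SUP_heis_ball:
  fixes g :: "heis \<Rightarrow> real"
  assumes g: "continuous_on UNIV g" and "0 < r"
  shows "continuous_on UNIV (\<lambda>q. SUP q'\<in>heis_ball r q. g q')"
proof -
  let ?S = "{b. koranyi_gauge b < r}" and ?C = "{b. heis_dist (0,0,0) b \<le> r}"
  have gauge: "heis_dist (0,0,0) b = koranyi_gauge b" for b
    by (simp add: heis_dist_def heis_group(2) del: koranyi_gauge.simps)
  have S: "?S \<subseteq> ?C" by (auto simp: gauge)
  have ne: "?S \<noteq> {}"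
    using \<open>0 < r\<close> by (metis empty_iff gauge heis_dist_self mem_Collect_eq)
  have "\<forall>e>0. \<forall>\<^sub>F q in at q0. dist (SUP b\<in>?S. g (q \<star> b)) (SUP b\<in>?S. g (q0 \<star> b)) < e" for q0
  proof (intro allI impI)
    fix e :: real assume "0 < e"
    \<comment> \<open>Compactness of the closed ball \<open>?C\<close> makes the continuity in
      \<open>q\<close> at \<open>q0\<close> uniform in \<open>b\<close>. The bound
      \<open>e / 2\<close> leaves room because passing to suprema yields only a weak
      inequality.\<close>
    have "continuous_on (UNIV \<times> ?C) (\<lambda>x. g (fst x \<star> snd x))"
      by (intro continuous_on_compose2[OF g] continuous_intros) auto
    from continuous_on_prod_compactE[OF this compact_heis_cball UNIV_I half_gt_zero[OF \<open>0 < e\<close>]]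
    obtain U where U: "q0 \<in> U" "open U"
      "\<forall>q\<in>U. \<forall>b\<in>?C. dist (g (q \<star> b)) (g (q0 \<star> b)) \<le> e / 2"
      by (metis (no_types, lifting) Int_UNIV_right fst_conv snd_conv)
    have bdd: "bdd_above ((\<lambda>b. g (q \<star> b)) ` ?S)" for q
      using bdd_heis_ball_image(1)[OF g, of r q] by (simp add: heis_ball_eq_translate image_image)
    have "\<bar>(SUP b\<in>?S. g (q \<star> b)) - (SUP b\<in>?S. g (q0 \<star> b))\<bar> \<le> e / 2" if "q \<in> U" for q
      using U(3) that S by (intro abs_SUP_diff_le ne bdd) (auto simp: dist_real_def subset_iff)
    then have "\<forall>q\<in>U. dist (SUP b\<in>?S. g (q \<star> b)) (SUP b\<in>?S. g (q0 \<star> b)) < e"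
      using \<open>0 < e\<close> by (fastforce simp: dist_real_def)
    then show "\<forall>\<^sub>F q in at q0. dist (SUP b\<in>?S. g (q \<star> b)) (SUP b\<in>?S. g (q0 \<star> b)) < e"
      using U(1,2) by (auto simp: eventually_at_topological)
  qed
  then have "continuous_on UNIV (\<lambda>q. SUP b\<in>?S. g (q \<star> b))"
    by (simp add: continuous_on_def tendsto_iff)
  then show ?thesis by (simp add: heis_ball_eq_translate image_image)
qed

lemma continuous_on_INF_heis_ball:
  fixes g :: "heis \<Rightarrow> real"
  assumes "continuous_on UNIV g" "0 < r"
  shows "continuous_on UNIV (\<lambda>q. INF q'\<in>heis_ball r q. g q')"
  unfolding INF_eq_uminus_SUP
  by (intro continuous_on_minus continuous_on_SUP_heis_ball assms)

section \<open>Distance to the complement of the domain, and the interpolation weight\<close>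

lemma abs_heis_setdist_diff_le:
  assumes "S \<noteq> {}"
  shows "\<bar>heis_setdist q S - heis_setdist q' S\<bar> \<le> heis_dist q q'"
proof -
  have bdd: "bdd_below (heis_dist q ` S)" for q
    by (rule bdd_belowI[of _ 0]) auto
  have "heis_setdist q S \<le> heis_setdist q' S + heis_dist q q'" for q q'
  proof -
    have "heis_setdist q S - heis_dist q q' \<le> heis_setdist q' S"
      unfolding heis_setdist_def[of q']
    proof (rule cINF_greatest[OF assms])
      fix s assume "s \<in> S"
      then have "heis_setdist q S \<le> heis_dist q s"
        unfolding heis_setdist_def by (intro cINF_lower bdd)
      then show "heis_setdist q S - heis_dist q q' \<le> heis_dist q' s"
        using heis_dist_triangle[of q s q'] by linarith
    qed
    then show ?thesis by linarith
  qed
  from this[of q q'] this[of q' q] show ?thesis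
    by (simp add: heis_dist_commute abs_le_iff)
qed

lemma continuous_on_heis_setdist:
  assumes "S \<noteq> {}" shows "continuous_on UNIV (\<lambda>q. heis_setdist q S)"
proof -
  have "((\<lambda>q. heis_setdist q S) \<longlongrightarrow> heis_setdist a S) (at a)" for a
  proof (rule Lim_transform_bound[where g = "\<lambda>q. heis_dist q a", THEN LIM_zero_cancel])
    show "\<forall>\<^sub>F q in at a. norm (heis_setdist q S - heis_setdist a S) \<le> norm (heis_dist q a)"
      using abs_heis_setdist_diff_le[OF assms] by simp
    have "continuous_on UNIV (\<lambda>q. heis_dist q a)" by (intro continuous_intros)
    then show "((\<lambda>q. heis_dist q a) \<longlongrightarrow> 0) (at a)"
      by (metis UNIV_I continuous_on_def heis_dist_self)
  qed
  then show ?thesis by (simp add: continuous_on_def)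
qed

lemma heis_setdist_nonneg: "S \<noteq> {} \<Longrightarrow> 0 \<le> heis_setdist q S"
  unfolding heis_setdist_def by (rule cINF_greatest) auto

text \<open>Guarantees that the infimum defining the distance to the complement is not taken over
  the empty set.\<close>

lemma bounded_heis_complement_nonempty:
  fixes D :: "heis set" shows "bounded D \<Longrightarrow> - D \<noteq> {}"
  by (metis Compl_UNIV_eq double_complement not_bounded_UNIV)

lemma continuous_on_d_eps:
  assumes "bounded D" shows "continuous_on UNIV (d_eps D \<epsilon>)"
  unfolding d_eps_def[abs_def]
  by (intro continuous_intros continuous_on_heis_setdist bounded_heis_complement_nonempty assms)

lemma d_eps_bounds:
  assumes "bounded D" "0 < \<epsilon>" shows "0 \<le> d_eps D \<epsilon> q" "d_eps D \<epsilon> q \<le> 1"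
  using heis_setdist_nonneg[OF bounded_heis_complement_nonempty[OF assms(1)], of q] assms(2)
  by (auto simp: d_eps_def min_def)

lemma d_eps_outside:
  assumes "bounded D" "0 < \<epsilon>" "q \<notin> D" shows "d_eps D \<epsilon> q = 0"
proof -
  have "bdd_below (heis_dist q ` (- D))"
    by (rule bdd_belowI[of _ 0]) auto
  then have "heis_setdist q (- D) \<le> heis_dist q q"
    unfolding heis_setdist_def using assms(3) by (intro cINF_lower) auto
  then show ?thesis
    using heis_setdist_nonneg[OF bounded_heis_complement_nonempty[OF assms(1)], of q] assms(2)
    by (simp add: d_eps_def)
qed

section \<open>Dini's theorem and limits of suprema\<close>

lemma uniform_limit_Dini:
  fixes f :: "nat \<Rightarrow> 'a::topological_space \<Rightarrow> real"
  assumes "compact K" and f: "\<And>n. continuous_on K (f n)" and g: "continuous_on K g"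
    and inc: "\<And>x. x \<in> K \<Longrightarrow> incseq (\<lambda>n. f n x)"
    and lim: "\<And>x. x \<in> K \<Longrightarrow> (\<lambda>n. f n x) \<longlonglongrightarrow> g x"
  shows "uniform_limit K f g sequentially"
proof (rule uniform_limitI)
  fix e :: real assume "0 < e"
  define U where "U n = {x \<in> K. g x - f n x < e}" for n
  have "openin (top_of_set K) (U n)" for n
  proof -
    have "U n = K \<inter> (\<lambda>x. g x - f n x) -` {..<e}" by (auto simp: U_def)
    then show ?thesis
      by (metis continuous_on_diff continuous_openin_preimage_gen f g open_lessThan)
  qed
  moreover have "K \<subseteq> \<Union> (range U)"
  proof
    fix x assume x: "x \<in> K"
    have "\<forall>\<^sub>F n in sequentially. g x - e < f n x"
      using order_tendstoD(1)[OF lim[OF x]] \<open>0 < e\<close> by simp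
    then obtain n where "g x - e < f n x"
      by (auto simp: eventually_sequentially)
    then show "x \<in> \<Union> (range U)" using x by (auto simp: U_def intro!: exI[of _ n])
  qed
  ultimately obtain \<U> where \<U>: "\<U> \<subseteq> range U" "finite \<U>" "K \<subseteq> \<Union> \<U>"
    using \<open>compact K\<close> unfolding compact_eq_openin_cover by (metis (no_types, lifting) imageE)
  then obtain A where A: "finite A" "\<U> = U ` A"
    using finite_subset_image by metis
  \<comment> \<open>The sets \<open>U n\<close> grow with \<open>n\<close>, so the largest index of
    the finite subcover serves all of \<open>K\<close>. Inserting \<open>0\<close> keeps
    \<open>Max\<close> meaningful for an empty index set.\<close>
  have "dist (f n x) (g x) < e" if n: "Max (insert 0 A) \<le> n" and x: "x \<in> K" for n x
  proof -
    obtain m where m: "m \<in> A" "x \<in> U m" using \<U>(3) A x by auto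
    then have "m \<le> n" using n A(1) by (auto simp: Max_ge order_trans)
    then have "f m x \<le> f n x" using inc[OF x] by (simp add: incseq_def)
    moreover have "f n x \<le> g x" using incseq_le[OF inc[OF x] lim[OF x]] .
    ultimately show ?thesis using m(2) by (simp add: U_def dist_real_def)
  qed
  then show "\<forall>\<^sub>F n in sequentially. \<forall>x\<in>K. dist (f n x) (g x) < e"
    unfolding eventually_sequentially by blast
qed

lemma tendsto_SUP_uniform_limit:
  fixes f :: "nat \<Rightarrow> 'a \<Rightarrow> real"
  assumes "S \<noteq> {}" "\<And>n. bdd_above (f n ` S)" "bdd_above (g ` S)" and u: "uniform_limit S f g F"
  shows "((\<lambda>n. SUP x\<in>S. f n x) \<longlongrightarrow> (SUP x\<in>S. g x)) F"
proof (rule tendstoI)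
  fix e :: real assume "0 < e"
  then have "\<forall>\<^sub>F n in F. \<forall>x\<in>S. dist (f n x) (g x) < e / 2"
    using uniform_limitD[OF u, of "e/2"] by simp
  then show "\<forall>\<^sub>F n in F. dist (SUP x\<in>S. f n x) (SUP x\<in>S. g x) < e"
  proof eventually_elim
    case (elim n)
    then have "\<bar>(SUP x\<in>S. f n x) - (SUP x\<in>S. g x)\<bar> \<le> e / 2"
      by (intro abs_SUP_diff_le assms) (auto simp: dist_real_def less_imp_le)
    then show ?case using \<open>0 < e\<close> by (simp add: dist_real_def)
  qed
qed

section \<open>The right-hand side as a monotone operator\<close>

text \<open>One step of the dynamic programming principle; solutions are exactly its locally
  integrable fixed points.\<close>

definition dpp_step ::
    "real \<Rightarrow> heis set \<Rightarrow> (heis \<Rightarrow> real) \<Rightarrow> real \<Rightarrow> (heis \<Rightarrow> real) \<Rightarrow> heis \<Rightarrow> real" where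
  "dpp_step p D F \<epsilon> u q =
     d_eps D \<epsilon> q *
       (1/3 * average3 u \<epsilon> q
        + 1/3 * (INF q'\<in>heis_ball (gamma_p p * \<epsilon>) q. average3 u \<epsilon> q')
        + 1/3 * (SUP q'\<in>heis_ball (gamma_p p * \<epsilon>) q. average3 u \<epsilon> q'))
     + (1 - d_eps D \<epsilon> q) * F q"

lemma is_solution_iff:
  "is_solution p D F \<epsilon> u \<longleftrightarrow> locally_integrable u \<and> (\<forall>q. u q = dpp_step p D F \<epsilon> u q)"
  by (simp add: is_solution_def dpp_step_def)

lemma gamma_p_pos: "2 < p \<Longrightarrow> 0 < gamma_p p"
  by (simp add: gamma_p_def)

context
  fixes p :: real and D :: "heis set" and \<epsilon> :: real
  assumes p: "2 < p" and D: "bounded D" and \<epsilon>: "0 < \<epsilon>"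
begin

lemma radius_pos: "0 < gamma_p p * \<epsilon>"
  using gamma_p_pos[OF p] \<epsilon> by simp

lemma continuous_on_dpp_step:
  assumes "locally_integrable u" "continuous_on UNIV F"
  shows "continuous_on UNIV (dpp_step p D F \<epsilon> u)"
  unfolding dpp_step_def[abs_def]
  by (intro continuous_intros continuous_on_d_eps D continuous_on_average3
      continuous_on_INF_heis_ball continuous_on_SUP_heis_ball radius_pos \<epsilon> assms)

text \<open>The shift \<open>c\<close> serves two purposes: \<open>c = 0\<close> gives monotonicity
  of the operator, and a positive maximum of the difference of two solutions enters the comparison
  proof as \<open>c\<close>.\<close>

lemma average3_extrema_mono:
  assumes u: "locally_integrable u" and v: "locally_integrable v"
    and le: "\<And>q. average3 u \<epsilon> q \<le> average3 v \<epsilon> q + c"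
  shows "(INF q'\<in>heis_ball (gamma_p p * \<epsilon>) q. average3 u \<epsilon> q')
      \<le> (INF q'\<in>heis_ball (gamma_p p * \<epsilon>) q. average3 v \<epsilon> q') + c"
    and "(SUP q'\<in>heis_ball (gamma_p p * \<epsilon>) q. average3 u \<epsilon> q')
      \<le> (SUP q'\<in>heis_ball (gamma_p p * \<epsilon>) q. average3 v \<epsilon> q') + c"
proof -
  let ?B = "heis_ball (gamma_p p * \<epsilon>) q"
  note ne = heis_ball_nonempty[OF radius_pos, of q]
  note bu = bdd_heis_ball_image[OF continuous_on_average3[OF u \<epsilon>], of "gamma_p p * \<epsilon>" q]
  note bv = bdd_heis_ball_image[OF continuous_on_average3[OF v \<epsilon>], of "gamma_p p * \<epsilon>" q]
  have "(INF q'\<in>?B. average3 u \<epsilon> q') - c \<le> (INF q'\<in>?B. average3 v \<epsilon> q')"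
  proof (rule cINF_greatest[OF ne])
    fix s assume "s \<in> ?B"
    from cINF_lower[OF bu(2) this] le[of s]
    show "(INF q'\<in>?B. average3 u \<epsilon> q') - c \<le> average3 v \<epsilon> s" by linarith
  qed
  then show "(INF q'\<in>?B. average3 u \<epsilon> q') \<le> (INF q'\<in>?B. average3 v \<epsilon> q') + c" by linarith
  show "(SUP q'\<in>?B. average3 u \<epsilon> q') \<le> (SUP q'\<in>?B. average3 v \<epsilon> q') + c"
  proof (rule cSUP_least[OF ne])
    fix s assume "s \<in> ?B"
    from cSUP_upper[OF this bv(1)] le[of s]
    show "average3 u \<epsilon> s \<le> (SUP q'\<in>?B. average3 v \<epsilon> q') + c" by linarith
  qed
qed

text \<open>The weights \<open>d_eps\<close> and \<open>1 - d_eps\<close> are nonnegative, and the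
  average, its infimum and its supremum are all monotone in the function.\<close>

lemma dpp_step_mono:
  assumes "locally_integrable u" "locally_integrable v" "\<And>q. u q \<le> v q"
    and "\<And>q. F q \<le> F' q"
  shows "dpp_step p D F \<epsilon> u q \<le> dpp_step p D F' \<epsilon> v q"
proof -
  have a: "average3 u \<epsilon> q \<le> average3 v \<epsilon> q + 0" for q
    using average3_mono[OF assms(1-3)] by simp
  note d = d_eps_bounds[OF D \<epsilon>, of q]
  show ?thesis
    unfolding dpp_step_def
    using average3_extrema_mono[OF assms(1,2) a, of q] a[of q] d assms(4)[of q]
    by (intro add_mono mult_left_mono) auto
qed

text \<open>Together with monotonicity this makes constants lower and upper barriers for the
  iteration.\<close>

lemma dpp_step_const: "dpp_step p D (\<lambda>_. c) \<epsilon> (\<lambda>_. c) q = c"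
proof -
  have "(INF q'\<in>heis_ball (gamma_p p * \<epsilon>) q. average3 (\<lambda>_. c) \<epsilon> q') = c"
    "(SUP q'\<in>heis_ball (gamma_p p * \<epsilon>) q. average3 (\<lambda>_. c) \<epsilon> q') = c"
    using heis_ball_nonempty[OF radius_pos, of q] by (simp_all add: average3_const[OF \<epsilon>])
  then show ?thesis
    by (simp add: dpp_step_def average3_const[OF \<epsilon>] algebra_simps)
qed

section \<open>Regularity and comparison of solutions\<close>

lemma solution_outside:
  assumes "is_solution p D F \<epsilon> u" "q \<notin> D" shows "u q = F q"
proof -
  have "u q = dpp_step p D F \<epsilon> u q" using assms(1) unfolding is_solution_iff by blast
  then show ?thesis by (simp add: dpp_step_def d_eps_outside[OF D \<epsilon> assms(2)])
qed

text \<open>The operator maps locally integrable functions to continuous ones, and a solution is its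
  own image.\<close>

lemma solution_continuous:
  assumes "is_solution p D F \<epsilon> u" "continuous_on UNIV F"
  shows "continuous_on UNIV u"
proof -
  have "u = dpp_step p D F \<epsilon> u" "locally_integrable u" using assms(1) unfolding is_solution_iff by auto
  then show ?thesis using continuous_on_dpp_step assms(2) by metis
qed

text \<open>Continuity bounds a solution on the compact closure of \<open>D\<close>; elsewhere it
  coincides with \<open>F\<close>.\<close>

lemma solution_bounded:
  assumes "is_solution p D F \<epsilon> u" "continuous_on UNIV F" "bounded (range F)"
  shows "bounded (range u)"
proof -
  have "compact (u ` closure D)"
    using D solution_continuous[OF assms(1,2)]
    by (meson compact_closure compact_continuous_image continuous_on_subset subset_UNIV)
  then have "bounded (u ` closure D \<union> range F)"
    using assms(3) compact_imp_bounded by auto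
  moreover have "range u \<subseteq> u ` closure D \<union> range F"
    using solution_outside[OF assms(1)] closure_subset by fastforce
  ultimately show ?thesis by (rule bounded_subset)
qed

text \<open>The set where \<open>u - u'\<close> attains a positive maximum is compact, and contains the
  \<open>\<epsilon>\<close>-ball around each of its points because the equation has the plain average among its
  terms. A point of this set with the largest first coordinate contradicts that.\<close>

lemma solution_mono:
  assumes F: "continuous_on UNIV F" and F': "continuous_on UNIV F'" and le: "\<And>q. F q \<le> F' q"
    and u: "is_solution p D F \<epsilon> u" and u': "is_solution p D F' \<epsilon> u'"
  shows "u q \<le> u' q"
proof (rule ccontr)
  assume "\<not> u q \<le> u' q"
  define w where "w q = u q - u' q" for q
  have w_cont: "continuous_on UNIV w"
    unfolding w_def[abs_def]
    by (intro continuous_intros solution_continuous[OF u F] solution_continuous[OF u' F'])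
  have li: "locally_integrable u" "locally_integrable u'" "locally_integrable w"
    using u u' continuous_imp_locally_integrable[OF w_cont] by (simp_all add: is_solution_def)
  have outside: "w q \<le> 0" if "q \<notin> D" for q
    using solution_outside[OF u that] solution_outside[OF u' that] le[of q] by (simp add: w_def)
  have "0 < w q" using \<open>\<not> u q \<le> u' q\<close> by (simp add: w_def)
  then have "q \<in> closure D" using outside[of q] closure_subset by (meson linorder_not_le subsetD)
  moreover have "compact (closure D)" "continuous_on (closure D) w"
    using D w_cont continuous_on_subset by (auto simp: compact_closure)
  ultimately obtain q0 where q0: "\<And>q. q \<in> closure D \<Longrightarrow> w q \<le> w q0"
    by (metis continuous_attains_sup empty_iff)
  define M where "M = w q0"
  have "0 < M" using q0[OF \<open>q \<in> closure D\<close>] \<open>0 < w q\<close> by (simp add: M_def)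
  have wM: "w q \<le> M" for q
    using q0[of q] outside[of q] \<open>0 < M\<close> closure_subset[of D] by (cases "q \<in> D") (auto simp: M_def)
  have avg: "average3 u \<epsilon> q \<le> average3 u' \<epsilon> q + M" for q
  proof -
    have "average3 w \<epsilon> q \<le> average3 (\<lambda>_. M) \<epsilon> q"
      by (intro average3_mono li continuous_imp_locally_integrable continuous_intros wM)
    then show ?thesis
      using average3_diff[OF li(1,2), of \<epsilon> q] by (simp add: w_def[abs_def] average3_const[OF \<epsilon>])
  qed
  have spread: "w s = M" if q: "w q = M" and s: "s \<in> heis_ball \<epsilon> q" for q s
  proof (rule average3_le_imp_eq_on_heis_ball[OF w_cont wM \<epsilon> _ s])
    let ?B = "heis_ball (gamma_p p * \<epsilon>) q" and ?d = "d_eps D \<epsilon> q"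
    \<comment> \<open>\<open>t\<close> is the difference of the two bracketed means, so that
      \<open>w q\<close> becomes a convex combination of \<open>t\<close> and the nonpositive
      \<open>F q - F' q\<close>. As \<open>M\<close> is positive and the weight at most 1, this
      forces \<open>M \<le> t\<close>.\<close>
    define t where "t = 1/3 * (average3 u \<epsilon> q - average3 u' \<epsilon> q)
      + 1/3 * ((INF q'\<in>?B. average3 u \<epsilon> q') - (INF q'\<in>?B. average3 u' \<epsilon> q'))
      + 1/3 * ((SUP q'\<in>?B. average3 u \<epsilon> q') - (SUP q'\<in>?B. average3 u' \<epsilon> q'))"
    note ext = average3_extrema_mono[OF li(1,2) avg, of q]
    \<comment> \<open>The infimum and supremum terms each contribute a difference of at most
      \<open>M\<close>, so a mean of the three differences that reaches \<open>M\<close> forces the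
      plain average to reach \<open>M\<close> as well.\<close>
    have weights: "M \<le> a" if "M \<le> 1/3 * a + 1/3 * (i - i') + 1/3 * (s - s')"
      "i \<le> i' + M" "s \<le> s' + M" for a i i' s s' :: real
      using that by (simp add: field_simps)
    have eq: "u q = dpp_step p D F \<epsilon> u q" "u' q = dpp_step p D F' \<epsilon> u' q"
      using u u' unfolding is_solution_iff by blast+
    have "w q = ?d * t + (1 - ?d) * (F q - F' q)"
      unfolding w_def eq t_def dpp_step_def by (simp add: algebra_simps)
    moreover have "(1 - ?d) * (F q - F' q) \<le> 0"
      using d_eps_bounds[OF D \<epsilon>, of q] le[of q] by (simp add: mult_nonneg_nonpos)
    ultimately have "M \<le> ?d * t" using q by simp
    moreover from this have "0 \<le> t"
      using \<open>0 < M\<close> d_eps_bounds(1)[OF D \<epsilon>, of q]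
      by (smt (verit) mult_nonneg_nonpos)
    ultimately have "M \<le> t"
      using d_eps_bounds(2)[OF D \<epsilon>, of q] mult_right_mono[of ?d 1 t] by simp
    then show "M \<le> average3 w \<epsilon> q"
      using weights[OF \<open>M \<le> t\<close>[unfolded t_def] ext] average3_diff[OF li(1,2), of \<epsilon> q]
      by (simp add: w_def[abs_def])
  qed
  define S where "S = {q. w q = M}"
  have "S \<subseteq> closure D"
    using outside \<open>0 < M\<close> closure_subset[of D] by (force simp: S_def)
  moreover have "closed S"
    unfolding S_def by (intro closed_Collect_eq w_cont continuous_intros)
  ultimately have "compact S"
    using D by (meson bounded_closure bounded_subset compact_eq_bounded_closed)
  moreover have "q0 \<in> S" by (simp add: S_def M_def)
  ultimately obtain q1 where q1: "q1 \<in> S" "\<And>q. q \<in> S \<Longrightarrow> fst q \<le> fst q1"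
    by (metis continuous_attains_sup continuous_on_fst continuous_on_id empty_iff)
  \<comment> \<open>A horizontal step of gauge \<open>\<epsilon> / 2\<close> stays inside the ball
    around \<open>q1\<close> and raises the first coordinate by the same amount.\<close>
  let ?q2 = "q1 \<star> (\<epsilon> / 2, 0, 0)"
  have "heis_dist q1 ?q2 < \<epsilon>"
    using \<epsilon> real_root_power_cancel[of 4 "\<epsilon> / 2"] by (simp add: heis_dist_mult_right)
  then have "?q2 \<in> S"
    using spread q1(1) by (simp add: S_def heis_ball_def)
  then have "fst ?q2 \<le> fst q1" by (rule q1(2))
  moreover have "fst ?q2 = fst q1 + \<epsilon> / 2" by (cases q1) simp
  ultimately show False using \<epsilon> by simp
qed

section \<open>Existence by monotone iteration\<close>

lemma solution_exists:
  assumes F: "continuous_on UNIV F" and bF: "bounded (range F)"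
  shows "\<exists>u. is_solution p D F \<epsilon> u"
proof -
  obtain M where M: "\<And>q. \<bar>F q\<bar> \<le> M" using bF by (auto simp: bounded_iff)
  let ?T = "dpp_step p D F \<epsilon>"
  define v where "v n = (?T ^^ n) (\<lambda>_. - M)" for n
  have v0: "v 0 = (\<lambda>_. - M)" and vS: "v (Suc n) = ?T (v n)" for n
    by (simp_all add: v_def)
  have cont: "continuous_on UNIV (v n)" for n
    by (induction n)
       (auto simp: v0 vS intro: continuous_on_dpp_step continuous_imp_locally_integrable F)
  note li = continuous_imp_locally_integrable[OF cont]
  have lic: "locally_integrable (\<lambda>_. c)" for c
    by (intro continuous_imp_locally_integrable continuous_intros)
  have FM: "- M \<le> F q" "F q \<le> M" for q using M[of q] by (simp_all add: abs_le_iff)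
  \<comment> \<open>The constant \<open>M\<close> is reproduced by the operator with data
    \<open>M\<close>, which dominates \<open>F\<close>.\<close>
  have upper: "v n q \<le> M" for n q
  proof (induction n arbitrary: q)
    case 0 then show ?case using M[of q] by (simp add: v0)
  next
    case (Suc n)
    have "?T (v n) q \<le> dpp_step p D (\<lambda>_. M) \<epsilon> (\<lambda>_. M) q"
      by (intro dpp_step_mono li lic Suc FM)
    then show ?case by (simp add: vS dpp_step_const)
  qed
  \<comment> \<open>The base case compares with the constant \<open>- M\<close>, reproduced by the
    operator with data \<open>- M\<close> below \<open>F\<close>; the inductive step is
    monotonicity.\<close>
  have inc: "v n q \<le> v (Suc n) q" for n q
  proof (induction n arbitrary: q)
    case 0
    have "dpp_step p D (\<lambda>_. - M) \<epsilon> (\<lambda>_. - M) q \<le> ?T (\<lambda>_. - M) q"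
      by (intro dpp_step_mono lic order_refl FM)
    then show ?case by (simp add: v0 vS dpp_step_const)
  next
    case (Suc n)
    have "?T (v n) q \<le> ?T (v (Suc n)) q"
      by (intro dpp_step_mono li Suc order_refl)
    then show ?case by (simp only: vS)
  qed
  then have incseq: "incseq (\<lambda>n. v n q)" for q by (simp add: incseq_SucI)
  have lower: "- M \<le> v n q" for n q
    using incseqD[OF incseq, of 0 n q] by (simp add: v0)
  define u where "u q = lim (\<lambda>n. v n q)" for q
  have lim: "(\<lambda>n. v n q) \<longlonglongrightarrow> u q" for q
  proof -
    obtain L where "(\<lambda>n. v n q) \<longlonglongrightarrow> L"
      using incseq_convergent[OF incseq, of q M] upper by metis
    then show ?thesis by (simp add: u_def limI)
  qed
  have u_meas: "u \<in> borel_measurable borel"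
    by (rule borel_measurable_LIMSEQ_real[OF lim borel_measurable_continuous_onI[OF cont]])
  have dom: "\<bar>v n q\<bar> \<le> M" for n q using lower[of n q] upper[of n q] by (simp add: abs_le_iff)
  have meas: "(\<lambda>q. indicat_real K q *\<^sub>R f q) \<in> borel_measurable lebesgue"
    if "K \<in> sets borel" "f \<in> borel_measurable borel" for K and f :: "heis \<Rightarrow> real"
    using that by (intro measurable_completion) simp
  \<comment> \<open>Dominated convergence with the constant bound \<open>M\<close>. General Borel
    sets of finite measure cover both uses: compact sets for the local integrability of
    \<open>u\<close>, and balls for the limits of averages.\<close>
  have conv: "integrable lebesgue (\<lambda>q. indicat_real K q *\<^sub>R u q)
      \<and> (\<lambda>n. LINT q:K|lebesgue. v n q) \<longlonglongrightarrow> (LINT q:K|lebesgue. u q)"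
    if K: "K \<in> sets borel" "K \<in> lmeasurable" for K
  proof -
    have w: "integrable lebesgue (\<lambda>q. indicat_real K q * M)"
      using K(2) by (intro integrable_mult_left integrable_real_indicator) (auto simp: fmeasurable_def)
    have l: "AE q in lebesgue. (\<lambda>n. indicat_real K q *\<^sub>R v n q) \<longlonglongrightarrow> indicat_real K q *\<^sub>R u q"
      by (intro AE_I2 tendsto_intros lim)
    have b: "AE q in lebesgue. norm (indicat_real K q *\<^sub>R v n q) \<le> indicat_real K q * M" for n
      using dom by (intro AE_I2) (auto simp: abs_mult intro!: mult_left_mono)
    note m = meas[OF K(1) u_meas] meas[OF K(1) borel_measurable_continuous_onI[OF cont]]
    show ?thesis
      unfolding set_lebesgue_integral_def
      using integrable_dominated_convergence[OF m w l b] integral_dominated_convergence[OF m w l b]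
      by blast
  qed
  have u: "locally_integrable u"
    unfolding locally_integrable_def set_integrable_def
    using conv lmeasurable_compact borel_compact by blast
  have avg_lim: "(\<lambda>n. average3 (v n) \<epsilon> q) \<longlonglongrightarrow> average3 u \<epsilon> q" for q
    unfolding average3_def
    using conv[of "heis_ball \<epsilon> q"] heis_ball_fmeasurable borel_open[OF open_heis_ball]
    by (intro tendsto_intros) blast
  have avg_cont: "continuous_on UNIV (average3 (v n) \<epsilon>)" "continuous_on UNIV (average3 u \<epsilon>)" for n
    by (intro continuous_on_average3 li u \<epsilon>)+
  \<comment> \<open>Dini is applied to the averages and not to the iterates:
    \<open>average3 u \<epsilon>\<close> is continuous because \<open>u\<close> is locally
    integrable, whereas continuity of \<open>u\<close> itself is not yet established.\<close>
  have "uniform_limit {s. heis_dist q s \<le> gamma_p p * \<epsilon>} (\<lambda>n. average3 (v n) \<epsilon>)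
      (average3 u \<epsilon>) sequentially" for q
  proof (rule uniform_limit_Dini[OF compact_heis_cball])
    show "incseq (\<lambda>n. average3 (v n) \<epsilon> s)" for s
      by (intro incseq_SucI average3_mono li inc)
  qed (use avg_cont avg_lim continuous_on_subset in blast)+
  then have unif: "uniform_limit (heis_ball (gamma_p p * \<epsilon>) q) (\<lambda>n. average3 (v n) \<epsilon>)
      (average3 u \<epsilon>) sequentially" for q
    using heis_ball_subset_cball uniform_limit_on_subset by blast
  have SUP_lim: "(\<lambda>n. SUP s\<in>heis_ball (gamma_p p * \<epsilon>) q. average3 (v n) \<epsilon> s)
      \<longlonglongrightarrow> (SUP s\<in>heis_ball (gamma_p p * \<epsilon>) q. average3 u \<epsilon> s)" for q
    by (intro tendsto_SUP_uniform_limit heis_ball_nonempty radius_pos bdd_heis_ball_image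
        avg_cont unif)
  have INF_lim: "(\<lambda>n. INF s\<in>heis_ball (gamma_p p * \<epsilon>) q. average3 (v n) \<epsilon> s)
      \<longlonglongrightarrow> (INF s\<in>heis_ball (gamma_p p * \<epsilon>) q. average3 u \<epsilon> s)" for q
    unfolding INF_eq_uminus_SUP
    by (intro tendsto_minus tendsto_SUP_uniform_limit heis_ball_nonempty radius_pos
        bdd_heis_ball_image continuous_on_minus avg_cont uniform_limit_intros unif)
  \<comment> \<open>The shifted iterates converge to the operator applied to \<open>u\<close>, but
    also to \<open>u\<close>, so uniqueness of limits gives the fixed point.\<close>
  have "(\<lambda>n. v (Suc n) q) \<longlonglongrightarrow> ?T u q" for q
    unfolding vS dpp_step_def by (intro tendsto_intros avg_lim SUP_lim INF_lim)
  then have "u q = ?T u q" for q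
    using LIMSEQ_unique[OF LIMSEQ_Suc[OF lim]] by blast
  then show ?thesis using u is_solution_iff by blast
qed

end

section \<open>Well-posedness and monotonicity of the solution operator\<close>

theorem theorem11p1:
  fixes p :: real and D :: "heis set" and F :: "heis \<Rightarrow> real"
  assumes "p > 2"
    and "open D" and "bounded D" and "connected D"
    and "continuous_on UNIV F" and "bounded (range F)"
  shows "\<forall>\<epsilon>\<in>{0<..<1}.
      (\<exists>!u. is_solution p D F \<epsilon> u)
    \<and> (\<forall>u. is_solution p D F \<epsilon> u \<longrightarrow> continuous_on UNIV u \<and> bounded (range u))
    \<and> (\<forall>F' u u'. continuous_on UNIV F' \<and> bounded (range F') \<and> (\<forall>q. F q \<le> F' q)
          \<and> is_solution p D F \<epsilon> u \<and> is_solution p D F' \<epsilon> u'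
        \<longrightarrow> (\<forall>q. u q \<le> u' q))"
proof (intro ballI conjI allI impI)
  fix \<epsilon> :: real assume "\<epsilon> \<in> {0<..<1}"
  then have \<epsilon>: "0 < \<epsilon>" by simp
  note ctx = assms(1,3) \<epsilon>
  show "\<exists>!u. is_solution p D F \<epsilon> u"
  proof (rule ex_ex1I)
    show "\<exists>u. is_solution p D F \<epsilon> u" by (rule solution_exists[OF ctx assms(5,6)])
    \<comment> \<open>Two solutions with the same data can be compared in both directions.\<close>
    show "u = u'" if "is_solution p D F \<epsilon> u" "is_solution p D F \<epsilon> u'" for u u'
      using solution_mono[OF ctx assms(5,5) order_refl] that by (intro ext antisym) auto
  qed
  show "continuous_on UNIV u" if "is_solution p D F \<epsilon> u" for u
    by (rule solution_continuous[OF ctx that assms(5)])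
  show "bounded (range u)" if "is_solution p D F \<epsilon> u" for u
    by (rule solution_bounded[OF ctx that assms(5,6)])
  show "u q \<le> u' q"
    if "continuous_on UNIV F' \<and> bounded (range F') \<and> (\<forall>q. F q \<le> F' q)
          \<and> is_solution p D F \<epsilon> u \<and> is_solution p D F' \<epsilon> u'" for F' u u' q
    using that solution_mono[OF ctx assms(5), of F' u u' q] by blast
qed

end
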